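(* (a) If $K$ is a finite index subgroup of a group $G$ and $K$ has property (VRC), then $G$ also has property (VRC). (b) The (finitary) direct product $\times_{i\in I}X_i$ of any family of groups $X_i$, $i \in I$, each of which has property (VRC), satisfies property (VRC).
   Context: A subgroup $H$ of a group $K$ is a retract of $K$ if there is a homomorphism $\rho: K \to H$ which restricts to the identity map on $H$. A subgroup $H$ of a group $G$ is a virtual retract of $G$ if there exists a subgroup $K \leqslant G$ with $|G:K|<\infty$, $H \subseteq K$, and $H$ a retract of $K$. A group $G$ has property (VRC) if every cyclic subgroup of $G$ is a virtual retract of $G$. The finitary direct product of $(X_i)_{i\in I}$ is the subgroup of the cartesian product consisting of the elements with only finitely many non-trivial coordinates. *)

theory Defs
  imports "HOL-Algebra.Algebra"
begin

definition finite_index_subgroup :: "('a, 'm) monoid_scheme \<Rightarrow> 'a set \<Rightarrow> bool" where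
  "finite_index_subgroup G K \<longleftrightarrow> subgroup K G \<and> finite (rcosets\<^bsub>G\<^esub> K)"

definition group_retract :: "('a, 'm) monoid_scheme \<Rightarrow> 'a set \<Rightarrow> bool" where
  "group_retract K H \<longleftrightarrow>
     subgroup H K \<and> (\<exists>\<rho> \<in> hom K (K\<lparr>carrier := H\<rparr>). \<forall>h\<in>H. \<rho> h = h)"

definition virtual_retract :: "('a, 'm) monoid_scheme \<Rightarrow> 'a set \<Rightarrow> bool" where
  "virtual_retract G H \<longleftrightarrow>
     subgroup H G \<and>
     (\<exists>K. finite_index_subgroup G K \<and> H \<subseteq> K \<and> group_retract (G\<lparr>carrier := K\<rparr>) H)"

(* G is meant to be a group; this is not part of the predicate. *)
definition has_VRC :: "('a, 'm) monoid_scheme \<Rightarrow> bool" where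
  "has_VRC G \<longleftrightarrow>
     (\<forall>C. subgroup C G \<and> cyclic_group (G\<lparr>carrier := C\<rparr>) \<longrightarrow> virtual_retract G C)"

end

theory Submission
  imports Defs
begin

text \<open>
  A group has (VRC) iff it is residually finite and every element \<open>x\<close> of infinite order has a
  power on which some homomorphism from a finite index subgroup to the integers does not vanish.
  Both conditions are inherited from a finite index subgroup and pull back along coordinate
  projections. For the converse direction of the criterion, a finite cyclic subgroup \<open>C\<close> is a
  retract of \<open>NC\<close>, where \<open>N\<close> is a finite index normal subgroup with \<open>N \<inter> C = 1\<close>. If \<open>x\<close> has infinite
  order, pass to a finite index normal subgroup \<open>N\<close>, make the homomorphism invariant under
  conjugation by \<open>x\<close> by averaging, extend it to \<open>\<Psi>\<close> on \<open>N\<langle>x\<rangle>\<close>, and retract the preimage of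
  \<open>\<Psi>(x)\<int>\<close> onto \<open>\<langle>x\<rangle>\<close>.
\<close>

section \<open>Finite index subgroups\<close>

text \<open>Elements with the same value of \<open>f\<close> lie in the same right coset of
  \<open>K\<close>, so there are at most as many cosets as values. Finite index is thus proved by
  exhibiting an invariant with finitely many values, possibly finer than the coset itself.\<close>

lemma (in group) finite_index_subgroupI:
  assumes K: "subgroup K G" and fin: "finite (f ` carrier G)"
    and f: "\<And>x y. \<lbrakk>x \<in> carrier G; y \<in> carrier G; f x = f y\<rbrakk> \<Longrightarrow> x \<otimes> inv y \<in> K"
  shows "finite_index_subgroup G K"
proof -
  define g where "g v = K #> inv_into (carrier G) f v" for v
  have "K #> x = g (f x)" if x: "x \<in> carrier G" for x
  proof -
    let ?y = "inv_into (carrier G) f (f x)"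
    have y: "?y \<in> carrier G" "f ?y = f x"
      using x by (auto intro: inv_into_into f_inv_into_f)
    have "x \<otimes> inv ?y \<in> K"
      using f[OF x y(1)] y(2) by simp
    then have "K #> (x \<otimes> inv ?y) = K"
      using K x y by (simp add: coset_join2)
    then show ?thesis
      unfolding g_def using coset_mult_inv1[OF _ x y(1)] K by (simp add: subgroup.subset)
  qed
  then have "rcosets K = g ` f ` carrier G"
    by (auto simp: RCOSETS_def)
  then show ?thesis
    using K fin by (simp add: finite_index_subgroup_def)
qed

lemma (in group) rcos_eqD:
  assumes K: "subgroup K G" and x: "x \<in> carrier G" and y: "y \<in> carrier G" and "K #> x = K #> y"
  shows "x \<otimes> inv y \<in> K"
  using coset_join1[OF _ _ K] coset_mult_inv2[OF assms(4) x y] K x y by (simp add: subgroup.subset)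

text \<open>Used with \<open>m_assoc\<close>: once words are associated to the right, an inverse
  pair at the front cancels only through these rules.\<close>

lemma (in group) inv_mult_cancel_left [simp]:
  "\<lbrakk>x \<in> carrier G; y \<in> carrier G\<rbrakk> \<Longrightarrow> inv x \<otimes> (x \<otimes> y) = y"
  "\<lbrakk>x \<in> carrier G; y \<in> carrier G\<rbrakk> \<Longrightarrow> x \<otimes> (inv x \<otimes> y) = y"
  by (simp_all flip: m_assoc)

lemma (in group) finite_index_subgroup_carrier: "finite_index_subgroup G (carrier G)"
  by (rule finite_index_subgroupI[where f = "\<lambda>_. ()"]) (auto simp: subgroup_self)

lemma (in group) finite_index_subgroup_Int:
  assumes K: "finite_index_subgroup G K" and L: "finite_index_subgroup G L"
  shows "finite_index_subgroup G (K \<inter> L)"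
proof (rule finite_index_subgroupI[where f = "\<lambda>x. (K #> x, L #> x)"])
  show "subgroup (K \<inter> L) G"
    using K L by (simp add: finite_index_subgroup_def subgroups_Inter_pair)
  have "(\<lambda>x. (K #> x, L #> x)) ` carrier G \<subseteq> (rcosets K) \<times> (rcosets L)"
    by (auto simp: RCOSETS_def)
  then show "finite ((\<lambda>x. (K #> x, L #> x)) ` carrier G)"
    using K L by (auto simp: finite_index_subgroup_def intro: finite_subset)
  show "x \<otimes> inv y \<in> K \<inter> L"
    if "x \<in> carrier G" "y \<in> carrier G" "(K #> x, L #> x) = (K #> y, L #> y)" for x y
    using that K L by (auto simp: finite_index_subgroup_def intro: rcos_eqD)
qed

text \<open>The factor \<open>carrier G\<close> gives the right value for empty \<open>A\<close>,
  where the bare intersection is the whole type.\<close>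

lemma (in group) finite_index_subgroup_INT:
  assumes "finite A" and "\<And>a. a \<in> A \<Longrightarrow> finite_index_subgroup G (L a)"
  shows "finite_index_subgroup G (carrier G \<inter> (\<Inter>a\<in>A. L a))"
  using assms
proof (induction A)
  case empty
  then show ?case by (simp add: finite_index_subgroup_carrier)
next
  case (insert a A)
  then have "finite_index_subgroup G (L a \<inter> (carrier G \<inter> (\<Inter>a\<in>A. L a)))"
    using finite_index_subgroup_Int by simp
  then show ?case by (simp add: Int_left_commute)
qed

lemma (in group) finite_index_subgroup_mono:
  assumes N: "finite_index_subgroup G N" and "subgroup M G" "N \<subseteq> M"
  shows "finite_index_subgroup G M"
proof (rule finite_index_subgroupI[where f = "\<lambda>x. N #> x"])
  show "finite ((\<lambda>x. N #> x) ` carrier G)"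
    by (rule finite_subset[of _ "rcosets N"]) (use N in \<open>auto simp: finite_index_subgroup_def RCOSETS_def\<close>)
  show "x \<otimes> inv y \<in> M" if "x \<in> carrier G" "y \<in> carrier G" "N #> x = N #> y" for x y
    using that assms by (meson finite_index_subgroup_def rcos_eqD subsetD)
qed fact

text \<open>With \<open>r\<close> a fixed representative of the coset of \<open>x\<close> modulo
  \<open>K\<close>, that coset and the coset of \<open>x \<otimes> inv r\<close> modulo
  \<open>L\<close> inside \<open>K\<close> determine the coset of \<open>x\<close> modulo
  \<open>L\<close>. This bounds the index of \<open>L\<close> by the product of the two
  indices.\<close>

lemma (in group) finite_index_subgroup_trans:
  assumes K: "finite_index_subgroup G K" and L: "finite_index_subgroup (G\<lparr>carrier := K\<rparr>) L"
  shows "finite_index_subgroup G L"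
proof -
  interpret K: subgroup K G
    using K by (simp add: finite_index_subgroup_def)
  interpret KG: group "G\<lparr>carrier := K\<rparr>"
    by (rule K.subgroup_is_group) (rule is_group)
  have sL: "subgroup L (G\<lparr>carrier := K\<rparr>)"
    using L by (simp add: finite_index_subgroup_def)
  define r where "r Q = (SOME y. y \<in> carrier G \<and> K #> y = Q)" for Q
  have r: "r (K #> x) \<in> carrier G" "K #> r (K #> x) = K #> x" if "x \<in> carrier G" for x
    using someI[of "\<lambda>y. y \<in> carrier G \<and> K #> y = K #> x" x] that by (auto simp: r_def)
  have rK: "x \<otimes> inv r (K #> x) \<in> K" if "x \<in> carrier G" for x
    using rcos_eqD[OF K.subgroup_axioms that r(1)[OF that]] r(2)[OF that] by simp
  define f where "f x = (K #> x, L #>\<^bsub>G\<lparr>carrier := K\<rparr>\<^esub> (x \<otimes> inv r (K #> x)))" for x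
  show ?thesis
  proof (rule finite_index_subgroupI[where f = f])
    show "subgroup L G"
      by (rule incl_subgroup[OF K.subgroup_axioms sL])
    have "f ` carrier G \<subseteq> (rcosets K) \<times> (rcosets\<^bsub>G\<lparr>carrier := K\<rparr>\<^esub> L)"
      using rK by (fastforce simp: f_def RCOSETS_def)
    then show "finite (f ` carrier G)"
      using K L by (auto simp: finite_index_subgroup_def intro: finite_subset)
    fix x y assume xy: "x \<in> carrier G" "y \<in> carrier G" "f x = f y"
    \<comment> \<open>The first components of \<open>f\<close> agree, so \<open>x\<close> and
      \<open>y\<close> share this representative, and it cancels in the quotient below.\<close>
    define z where "z = r (K #> x)"
    have z: "z \<in> carrier G" "x \<otimes> inv z \<in> K" "y \<otimes> inv z \<in> K"
      using xy rK[OF xy(1)] rK[OF xy(2)] r by (auto simp: z_def f_def)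
    have "L #>\<^bsub>G\<lparr>carrier := K\<rparr>\<^esub> (x \<otimes> inv z) = L #>\<^bsub>G\<lparr>carrier := K\<rparr>\<^esub> (y \<otimes> inv z)"
      using xy(3) by (auto simp: f_def z_def)
    then have "(x \<otimes> inv z) \<otimes> inv (y \<otimes> inv z) \<in> L"
      using KG.rcos_eqD[OF sL, of "x \<otimes> inv z" "y \<otimes> inv z"] z
      by (simp add: m_inv_consistent[OF K.subgroup_axioms])
    then show "x \<otimes> inv y \<in> L"
      using xy z by (simp add: m_assoc inv_mult_group)
  qed
qed

text \<open>Pigeonhole: two distinct powers of \<open>x\<close> share a coset of \<open>K\<close>,
  and their quotient is a positive power of \<open>x\<close> in \<open>K\<close>.\<close>

lemma (in group) finite_index_pow:
  assumes K: "finite_index_subgroup G K" and x: "x \<in> carrier G"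
  obtains m :: nat where "m > 0" "x [^] m \<in> K"
proof -
  have "range (\<lambda>n::nat. K #> x [^] n) \<subseteq> rcosets K"
    using x by (auto simp: RCOSETS_def)
  then have "finite (range (\<lambda>n::nat. K #> x [^] n))"
    using K by (auto simp: finite_index_subgroup_def intro: finite_subset)
  then have "\<not> inj (\<lambda>n::nat. K #> x [^] n)"
    using range_inj_infinite by blast
  then obtain i j :: nat where ij: "i < j" "K #> x [^] j = K #> x [^] i"
    unfolding inj_def by (metis linorder_neqE_nat)
  have "x [^] j \<otimes> inv (x [^] i) \<in> K"
    using K x ij by (intro rcos_eqD) (auto simp: finite_index_subgroup_def)
  moreover have "x [^] j = x [^] (j - i) \<otimes> x [^] i"
    using x ij by (simp add: nat_pow_mult)
  ultimately have "x [^] (j - i) \<in> K"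
    using x by (simp add: m_assoc)
  then show ?thesis using that[of "j - i"] ij by simp
qed

text \<open>The coset of \<open>h x\<close> modulo \<open>K\<close> is an invariant of
  \<open>x\<close> with finitely many values, and it determines the coset of \<open>x\<close> modulo
  the preimage.\<close>

lemma finite_index_subgroup_vimage:
  assumes "group_hom G H h" and K: "finite_index_subgroup H K"
  shows "finite_index_subgroup G {x \<in> carrier G. h x \<in> K}"
proof -
  interpret group_hom G H h by fact
  interpret K: subgroup K H using K by (simp add: finite_index_subgroup_def)
  show ?thesis
  proof (rule G.finite_index_subgroupI[where f = "\<lambda>x. K #>\<^bsub>H\<^esub> h x"])
    show "subgroup {x \<in> carrier G. h x \<in> K} G"
      by unfold_locales auto
    have "(\<lambda>x. K #>\<^bsub>H\<^esub> h x) ` carrier G \<subseteq> rcosets\<^bsub>H\<^esub> K"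
      using hom_closed by (fastforce simp: RCOSETS_def)
    then show "finite ((\<lambda>x. K #>\<^bsub>H\<^esub> h x) ` carrier G)"
      using K by (auto simp: finite_index_subgroup_def intro: finite_subset)
    show "x \<otimes>\<^bsub>G\<^esub> inv\<^bsub>G\<^esub> y \<in> {x \<in> carrier G. h x \<in> K}"
      if "x \<in> carrier G" "y \<in> carrier G" "K #>\<^bsub>H\<^esub> h x = K #>\<^bsub>H\<^esub> h y" for x y
      using that H.rcos_eqD[OF K.subgroup_axioms, of "h x" "h y"] by simp
  qed
qed

text \<open>The kernel of the right translation action on the cosets of \<open>L\<close>.\<close>
lemma (in group) finite_index_normal_core:
  assumes L: "finite_index_subgroup G L"
  obtains N where "finite_index_subgroup G N" "N \<lhd> G" "N \<subseteq> L"
proof -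
  interpret L: subgroup L G using L by (simp add: finite_index_subgroup_def)
  \<comment> \<open>The condition at \<open>g\<close> says that right translation by
    \<open>x\<close> fixes the coset \<open>L #> g\<close>.\<close>
  define N where "N = {x \<in> carrier G. \<forall>g\<in>carrier G. g \<otimes> x \<otimes> inv g \<in> L}"
  have sN: "subgroup N G"
  proof
    show "x \<otimes> y \<in> N" if "x \<in> N" "y \<in> N" for x y
    proof -
      have "g \<otimes> (x \<otimes> y) \<otimes> inv g \<in> L" if g: "g \<in> carrier G" for g
      proof -
        have "(g \<otimes> x \<otimes> inv g) \<otimes> (g \<otimes> y \<otimes> inv g) \<in> L"
          using \<open>x \<in> N\<close> \<open>y \<in> N\<close> g by (auto simp: N_def)
        then show ?thesis
          using \<open>x \<in> N\<close> \<open>y \<in> N\<close> g by (simp add: N_def m_assoc inv_mult_group)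
      qed
      then show ?thesis using that by (auto simp: N_def)
    qed
    show "inv x \<in> N" if "x \<in> N" for x
    proof -
      have "g \<otimes> inv x \<otimes> inv g \<in> L" if g: "g \<in> carrier G" for g
      proof -
        have "inv (g \<otimes> x \<otimes> inv g) \<in> L"
          using \<open>x \<in> N\<close> g by (auto simp: N_def)
        then show ?thesis
          using \<open>x \<in> N\<close> g by (simp add: N_def m_assoc inv_mult_group)
      qed
      then show ?thesis using that by (auto simp: N_def)
    qed
  qed (auto simp: N_def)
  have normal: "N \<lhd> G"
  proof (rule normal_invI[OF sN])
    fix x h assume x: "x \<in> carrier G" and h: "h \<in> N"
    then have hc: "h \<in> carrier G" by (simp add: N_def)
    have "g \<otimes> (x \<otimes> h \<otimes> inv x) \<otimes> inv g \<in> L" if g: "g \<in> carrier G" for g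
    proof -
      have "(g \<otimes> x) \<otimes> h \<otimes> inv (g \<otimes> x) \<in> L"
        using h x g unfolding N_def by blast
      then show ?thesis using x hc g by (simp add: m_assoc inv_mult_group)
    qed
    then show "x \<otimes> h \<otimes> inv x \<in> N" using x hc by (simp add: N_def)
  qed
  have "finite_index_subgroup G N"
  \<comment> \<open>The invariant of \<open>x\<close> is its action on the finite set of cosets;
    restricting the map to that set makes it extensional, so only finitely many values are
    possible.\<close>
  proof (rule finite_index_subgroupI[where f = "\<lambda>x. \<lambda>Q\<in>rcosets L. Q #> x", OF sN])
    have "(\<lambda>x. \<lambda>Q\<in>rcosets L. Q #> x) ` carrier G \<subseteq> rcosets L \<rightarrow>\<^sub>E rcosets L"
      by (force simp: RCOSETS_def coset_mult_assoc L.subset)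
    then show "finite ((\<lambda>x. \<lambda>Q\<in>rcosets L. Q #> x) ` carrier G)"
      by (rule finite_subset) (use L in \<open>simp add: finite_index_subgroup_def finite_PiE\<close>)
    fix x y assume xy: "x \<in> carrier G" "y \<in> carrier G"
      and eq: "(\<lambda>Q\<in>rcosets L. Q #> x) = (\<lambda>Q\<in>rcosets L. Q #> y)"
    have "g \<otimes> (x \<otimes> inv y) \<otimes> inv g \<in> L" if g: "g \<in> carrier G" for g
    proof -
      have "L #> g \<in> rcosets L" using g by (auto simp: RCOSETS_def)
      then have "(L #> g) #> x = (L #> g) #> y"
        using fun_cong[OF eq, of "L #> g"] by simp
      then have "L #> (g \<otimes> x) = L #> (g \<otimes> y)"
        using g xy by (simp add: coset_mult_assoc L.subset)
      then have "(g \<otimes> x) \<otimes> inv (g \<otimes> y) \<in> L"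
        using g xy by (intro rcos_eqD) (auto intro: L.subgroup_axioms)
      then show ?thesis using g xy by (simp add: m_assoc inv_mult_group)
    qed
    then show "x \<otimes> inv y \<in> N" using xy by (simp add: N_def)
  qed
  moreover have "N \<subseteq> L"
  proof
    fix x assume "x \<in> N"
    then have "x \<in> carrier G" "\<one> \<otimes> x \<otimes> inv \<one> \<in> L"
      unfolding N_def by blast+
    then show "x \<in> L" by simp
  qed
  ultimately show ?thesis using normal that by blast
qed

text \<open>The set is the preimage of the multiples of \<open>s\<close>, of finite index in the
  integers. It serves as the domain of a retraction, and with \<open>s = 2\<close> it separates an
  element of value 1 from the identity.\<close>

lemma (in group) finite_index_hom_dvd:
  assumes L: "finite_index_subgroup G L" and \<phi>: "\<phi> \<in> hom (G\<lparr>carrier := L\<rparr>) integer_group"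
    and s: "s \<noteq> 0"
  shows "finite_index_subgroup G {x \<in> L. s dvd \<phi> x}"
proof -
  interpret L: subgroup L G using L by (simp add: finite_index_subgroup_def)
  interpret LG: group "G\<lparr>carrier := L\<rparr>"
    by (rule L.subgroup_is_group) (rule is_group)
  interpret \<phi>: group_hom "G\<lparr>carrier := L\<rparr>" integer_group \<phi>
    using \<phi> by (intro group_hom.intro) (auto simp: group_hom_axioms_def)
  have "finite_index_subgroup integer_group {n. s dvd n}"
  proof (rule group.finite_index_subgroupI[where f = "\<lambda>n. n mod s"])
    show "subgroup {n. s dvd n} integer_group"
      by (rule group.subgroupI) auto
    \<comment> \<open>A nonzero remainder has the sign of \<open>s\<close>, so a symmetric interval
      covers both signs.\<close>
    have "(\<lambda>n. n mod s) ` carrier integer_group \<subseteq> {-\<bar>s\<bar>..\<bar>s\<bar>}"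
      using s by (auto simp: abs_if) (smt (verit) neg_mod_bound neg_mod_sign pos_mod_bound pos_mod_sign)+
    then show "finite ((\<lambda>n. n mod s) ` carrier integer_group)"
      by (rule finite_subset) simp
  qed (auto simp: mod_eq_dvd_iff)
  then have "finite_index_subgroup (G\<lparr>carrier := L\<rparr>) {x \<in> carrier (G\<lparr>carrier := L\<rparr>). \<phi> x \<in> {n. s dvd n}}"
    by (rule finite_index_subgroup_vimage[OF \<phi>.group_hom_axioms])
  then show ?thesis using finite_index_subgroup_trans[OF L] by simp
qed


section \<open>Retractions onto cyclic subgroups from integer-valued homomorphisms\<close>

lemma (in group) subgroup_range_int_pow:
  "x \<in> carrier G \<Longrightarrow> subgroup (range (\<lambda>n::int. x [^] n)) G"
  using generate_is_subgroup[of "{x}"] generate_pow[of x] by (simp add: full_SetCompr_eq)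

lemma (in group) finite_range_int_pow:
  "\<lbrakk>x \<in> carrier G; ord x \<noteq> 0\<rbrakk> \<Longrightarrow> finite (range (\<lambda>n::int. x [^] n))"
  using finite_cyclic_subgroup_order[of x] generate_pow[of x]
  by (simp add: full_SetCompr_eq carrier_subgroup_generated)

lemma (in group) cyclic_group_subgroup_iff:
  assumes C: "subgroup C G"
  shows "cyclic_group (G\<lparr>carrier := C\<rparr>) \<longleftrightarrow> (\<exists>x\<in>C. C = range (\<lambda>n::int. x [^] n))"
  using group.cyclic_group[OF subgroup.subgroup_is_group[OF C is_group]]
  by (simp add: int_pow_consistent[OF C, symmetric] cong: bex_cong)

lemma (in group) virtual_retractI:
  assumes K: "finite_index_subgroup G K" and H: "subgroup H G" "H \<subseteq> K"
    and \<rho>: "\<And>x. x \<in> K \<Longrightarrow> \<rho> x \<in> H" "\<And>x y. \<lbrakk>x \<in> K; y \<in> K\<rbrakk> \<Longrightarrow> \<rho> (x \<otimes> y) = \<rho> x \<otimes> \<rho> y"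
      "\<And>h. h \<in> H \<Longrightarrow> \<rho> h = h"
  shows "virtual_retract G H"
proof -
  have "subgroup H (G\<lparr>carrier := K\<rparr>)"
    using K H by (auto simp: finite_index_subgroup_def intro: subgroup_incl)
  moreover have "\<rho> \<in> hom (G\<lparr>carrier := K\<rparr>) (G\<lparr>carrier := K, carrier := H\<rparr>)"
    using \<rho> by (auto simp: hom_def)
  ultimately have "group_retract (G\<lparr>carrier := K\<rparr>) H"
    using \<rho>(3) unfolding group_retract_def by auto
  then show ?thesis
    using K H unfolding virtual_retract_def by blast
qed

text \<open>The retraction sends \<open>x\<close> to \<open>c [^] (\<phi> x div \<phi> c)\<close>.
  Its domain is the part of \<open>M\<close> where the division is exact, since there the quotient
  is additive in \<open>x\<close>; powers of \<open>c\<close> are fixed because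
  \<open>\<phi>\<close> multiplies exponents by \<open>\<phi> c\<close>.\<close>

lemma (in group) virtual_retract_range_int_pow:
  assumes M: "finite_index_subgroup G M" and \<phi>: "\<phi> \<in> hom (G\<lparr>carrier := M\<rparr>) integer_group"
    and c: "c \<in> M" "\<phi> c \<noteq> 0"
  shows "virtual_retract G (range (\<lambda>n::int. c [^] n))"
proof -
  interpret M: subgroup M G using M by (simp add: finite_index_subgroup_def)
  have "\<phi> (c [^] n) = n * \<phi> c" for n :: int
    using hom_int_pow[OF \<phi>, of c n] c M.subgroup_is_group[OF is_group]
    by (simp add: int_pow_consistent[OF M.subgroup_axioms])
  moreover have "c [^] n \<in> M" for n :: int
    by (rule subgroup_int_pow_closed[OF M.subgroup_axioms c(1)])
  moreover have "\<phi> (x \<otimes> y) = \<phi> x + \<phi> y" if "x \<in> M" "y \<in> M" for x y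
    using hom_mult[OF \<phi>] that by simp
  ultimately show ?thesis
    using c M.subset
    by (intro virtual_retractI[OF finite_index_hom_dvd[OF M \<phi> c(2)],
          where \<rho> = "\<lambda>x. c [^] (\<phi> x div \<phi> c)"])
      (auto simp: subgroup_range_int_pow int_pow_mult div_plus_div_distrib_dvd_left)
qed

text \<open>Here \<open>c\<close> itself may lie outside \<open>N\<close>. A homomorphism on
  \<open>N\<close> that is invariant under conjugation by \<open>c\<close> extends to the products
  of \<open>N\<close> with powers of \<open>c\<close>, provided that the value chosen at
  \<open>c\<close> is consistent with those powers of \<open>c\<close> that already lie in
  \<open>N\<close>.\<close>

lemma (in group) hom_integer_group_extend:
  assumes N: "finite_index_subgroup G N" "N \<lhd> G" and \<phi>: "\<phi> \<in> hom (G\<lparr>carrier := N\<rparr>) integer_group"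
    and c: "c \<in> carrier G" "c [^] (k::nat) \<in> N" "\<phi> (c [^] k) \<noteq> 0"
  obtains M \<Psi> where "finite_index_subgroup G M" "c \<in> M"
    "\<Psi> \<in> hom (G\<lparr>carrier := M\<rparr>) integer_group" "\<Psi> c \<noteq> 0"
proof -
  interpret N: normal N G by (rule N)
  have sN: "subgroup N G" by (rule N.subgroup_axioms)
  have \<phi>_mult: "\<phi> (x \<otimes> y) = \<phi> x + \<phi> y" if "x \<in> N" "y \<in> N" for x y
    using hom_mult[OF \<phi>] that by simp
  have \<phi>_pow: "\<phi> (x [^] n) = n * \<phi> x" if "x \<in> N" for x and n :: int
    using hom_int_pow[OF \<phi>, of x n] that N.subgroup_is_group[OF is_group]
    by (simp add: int_pow_consistent[OF sN])
  define s where "s = \<phi> (c [^] k)"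
  define a where "a j x = c [^] j \<otimes> x \<otimes> c [^] (- j)" for j :: int and x
  have aN: "a j x \<in> N" if "x \<in> N" for j x
    using N.inv_op_closed2[of "c [^] j" x] c that by (simp add: a_def int_pow_neg)
  have a_add: "a i (a j x) = a (i + j) x" if "x \<in> carrier G" for i j x
  proof -
    have "c [^] (- (i + j)) = c [^] (- j) \<otimes> c [^] (- i)"
      using int_pow_mult[OF c(1), of "- j" "- i"] by (simp only: minus_add add.commute)
    then show ?thesis using c that by (simp add: a_def m_assoc int_pow_mult)
  qed
  have a_mult: "a j (x \<otimes> y) = a j x \<otimes> a j y" if "x \<in> carrier G" "y \<in> carrier G" for j x y
    using c that by (simp add: a_def m_assoc int_pow_neg)
  have a0: "a 0 x = x" if "x \<in> carrier G" for x
    using that by (simp add: a_def)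
  have a_pow: "a j (c [^] i) = c [^] i" for i j :: int
    using c by (simp add: a_def flip: int_pow_mult)
  \<comment> \<open>\<open>\<psi>\<close> is invariant under conjugation by \<open>c\<close> because conjugation by \<open>c\<^sup>k \<in> N\<close> does not change \<open>\<phi>\<close>;
    it multiplies \<open>\<phi>\<close> on powers of \<open>c\<close> by \<open>k\<close>, so that the extension can send \<open>c\<close> to \<open>\<phi> (c\<^sup>k)\<close>
    without division.\<close>
  define \<psi> where "\<psi> x = (\<Sum>i<k. \<phi> (a (int i) x))" for x
  have \<psi>_mult: "\<psi> (x \<otimes> y) = \<psi> x + \<psi> y" if "x \<in> N" "y \<in> N" for x y
    using that by (simp add: \<psi>_def a_mult \<phi>_mult aN sum.distrib)
  have \<psi>_a1: "\<psi> (a 1 x) = \<psi> x" if x: "x \<in> N" for x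
  proof -
    have "\<phi> (a (int k) x) = \<phi> (a 0 x)"
    proof -
      have "a (int k) x \<otimes> c [^] k = c [^] k \<otimes> x"
        using c x by (simp add: a_def m_assoc int_pow_int int_pow_neg)
      then have "\<phi> (a (int k) x) + \<phi> (c [^] k) = \<phi> (c [^] k) + \<phi> x"
        using \<phi>_mult aN x c by metis
      then show ?thesis using x by (simp add: a0)
    qed
    moreover have "\<psi> (a 1 x) = (\<Sum>i<k. \<phi> (a (int (Suc i)) x))"
      using x by (simp add: \<psi>_def a_add add.commute)
    \<comment> \<open>Both sides are the sum over all exponents from 0 to \<open>k\<close>, with the
      first or the last term split off.\<close>
    moreover have "(\<Sum>i<k. \<phi> (a (int (Suc i)) x)) + \<phi> (a 0 x) = \<psi> x + \<phi> (a (int k) x)"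
      using sum.lessThan_Suc_shift[of "\<lambda>i. \<phi> (a (int i) x)" k] by (simp add: \<psi>_def)
    ultimately show ?thesis by simp
  qed
  have \<psi>_a: "\<psi> (a j x) = \<psi> x" if x: "x \<in> N" for j x
  proof (induction j rule: int_induct[where k = 0])
    case base
    then show ?case using x by (simp add: a0)
  next
    case (step1 i)
    then show ?case using \<psi>_a1[OF aN[OF x], of i] x by (simp add: a_add add.commute)
  next
    case (step2 i)
    then show ?case using \<psi>_a1[OF aN[OF x], of "i - 1"] x by (simp add: a_add)
  qed
  \<comment> \<open>Since \<open>\<phi>\<close> may be undefined at \<open>c\<close>, the exponents
    are exchanged through the common power of \<open>c [^] d\<close> and \<open>c [^] k\<close>,
    both of which lie in \<open>N\<close>.\<close>
  have \<psi>_c: "\<psi> (c [^] d) = d * s" if d: "c [^] d \<in> N" for d :: int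
  proof -
    have "\<psi> (c [^] d) = int k * \<phi> (c [^] d)"
      by (simp add: \<psi>_def a_pow)
    also have "\<dots> = \<phi> ((c [^] k) [^] d)"
      using \<phi>_pow[OF d, of "int k"] c by (simp add: int_pow_pow mult.commute flip: int_pow_int)
    also have "\<dots> = d * s"
      using \<phi>_pow[OF c(2)] by (simp add: s_def)
    finally show ?thesis .
  qed
  define M where "M = {n \<otimes> c [^] j | n j::int. n \<in> N}"
  \<comment> \<open>An element of \<open>M\<close> can be written as
    \<open>n \<otimes> c [^] j\<close> in several ways, since powers of \<open>c\<close> lie in
    \<open>N\<close>; \<open>\<psi>_c\<close> is what makes all of them give the same value.\<close>
  define \<Psi> where "\<Psi> x = (SOME v. \<exists>n (j::int). n \<in> N \<and> x = n \<otimes> c [^] j \<and> v = \<psi> n + j * s)" for x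
  have \<Psi>: "\<Psi> (n \<otimes> c [^] j) = \<psi> n + j * s" if n: "n \<in> N" for n j
    unfolding \<Psi>_def
  proof (rule some_equality)
    fix v assume "\<exists>n' (j'::int). n' \<in> N \<and> n \<otimes> c [^] j = n' \<otimes> c [^] j' \<and> v = \<psi> n' + j' * s"
    then obtain n' and j' :: int
      where n': "n' \<in> N" "n \<otimes> c [^] j = n' \<otimes> c [^] j'" "v = \<psi> n' + j' * s" by blast
    have "n = (n \<otimes> c [^] j) \<otimes> c [^] (- j)"
      using n c by (simp add: m_assoc flip: int_pow_mult)
    also have "\<dots> = n' \<otimes> c [^] (j' - j)"
      using n' c by (simp add: m_assoc flip: int_pow_mult)
    finally have eq: "n = n' \<otimes> c [^] (j' - j)" .
    then have "c [^] (j' - j) = inv n' \<otimes> n"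
      using n' c by simp
    then have "c [^] (j' - j) \<in> N" using n n' by simp
    then have "\<psi> n = \<psi> n' + (j' - j) * s"
      using eq \<psi>_mult[OF n'(1)] \<psi>_c by simp
    then show "v = \<psi> n + j * s" using n' by (simp add: algebra_simps)
  qed (use n in blast)
  \<comment> \<open>Moving \<open>c [^] i\<close> past \<open>n'\<close> conjugates
    \<open>n'\<close>. This closes \<open>M\<close> under products, and invariance of
    \<open>\<psi>\<close> under \<open>a i\<close> then makes \<open>\<Psi>\<close>
    additive.\<close>
  have mult_eq: "(n \<otimes> c [^] i) \<otimes> (n' \<otimes> c [^] j) = (n \<otimes> a i n') \<otimes> c [^] (i + j)"
    if "n \<in> N" "n' \<in> N" for n n' i j
    using that c by (simp add: a_def m_assoc flip: int_pow_mult)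
  have MI: "n \<otimes> c [^] j \<in> M" if "n \<in> N" for n and j :: int
    using that unfolding M_def by blast
  have ME: "\<exists>n\<in>N. \<exists>j::int. x = n \<otimes> c [^] j" if "x \<in> M" for x
    using that unfolding M_def by blast
  have NM: "N \<subseteq> M"
    using MI[of _ 0] by auto
  have "subgroup M G"
  proof
    show "M \<subseteq> carrier G" using c by (auto simp: M_def)
    show "\<one> \<in> M" using NM by auto
    show "x \<otimes> y \<in> M" if xy: "x \<in> M" "y \<in> M" for x y
    proof -
      obtain n n' and i j :: int
        where "n \<in> N" "n' \<in> N" "x = n \<otimes> c [^] i" "y = n' \<otimes> c [^] j"
        using ME[OF xy(1)] ME[OF xy(2)] by blast
      then show ?thesis by (simp add: mult_eq aN MI)
    qed
    show "inv x \<in> M" if "x \<in> M" for x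
    proof -
      obtain n and j :: int where x: "n \<in> N" "x = n \<otimes> c [^] j" using ME \<open>x \<in> M\<close> by blast
      then have "inv x = a (- j) (inv n) \<otimes> c [^] (- j)"
        using c by (simp add: a_def m_assoc inv_mult_group flip: int_pow_mult int_pow_neg)
      then show ?thesis using x by (simp add: aN MI)
    qed
  qed
  then have "finite_index_subgroup G M"
    using finite_index_subgroup_mono[OF N(1)] NM by blast
  moreover have c1: "c = \<one> \<otimes> c [^] (1::int)" using c by simp
  then have "c \<in> M" using MI[OF N.one_closed] by metis
  moreover have "\<Psi> \<in> hom (G\<lparr>carrier := M\<rparr>) integer_group"
  proof (rule homI)
    fix x y assume "x \<in> carrier (G\<lparr>carrier := M\<rparr>)" "y \<in> carrier (G\<lparr>carrier := M\<rparr>)"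
    then have xy: "x \<in> M" "y \<in> M" by simp_all
    then obtain n n' and i j :: int
      where "n \<in> N" "n' \<in> N" "x = n \<otimes> c [^] i" "y = n' \<otimes> c [^] j"
      using ME[OF xy(1)] ME[OF xy(2)] by blast
    then show "\<Psi> (x \<otimes>\<^bsub>G\<lparr>carrier := M\<rparr>\<^esub> y) = \<Psi> x \<otimes>\<^bsub>integer_group\<^esub> \<Psi> y"
      by (simp add: mult_eq \<Psi> aN \<psi>_mult \<psi>_a distrib_right)
  qed simp
  moreover have "\<Psi> c \<noteq> 0"
  proof -
    have "\<psi> \<one> = 0" using \<psi>_mult[of \<one> \<one>] by simp
    then show ?thesis using \<Psi>[of \<one> 1] c1 c(3) by (simp add: s_def)
  qed
  ultimately show ?thesis using that by blast
qed

section \<open>The criterion: residual finiteness and virtual characters\<close>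

text \<open>Equivalent to separation by normal subgroups of finite index, because the normal core of
  \<open>L\<close> omits \<open>x\<close> as well.\<close>

definition residually_finite :: "('a, 'm) monoid_scheme \<Rightarrow> bool" where
  "residually_finite G \<longleftrightarrow>
     (\<forall>x\<in>carrier G. x \<noteq> \<one>\<^bsub>G\<^esub> \<longrightarrow> (\<exists>L. finite_index_subgroup G L \<and> x \<notin> L))"

text \<open>Since \<open>\<phi> \<one> = 0\<close>, the last condition forces \<open>k > 0\<close> and \<open>x\<close> to have infinite order.\<close>
definition has_virtual_character :: "('a, 'm) monoid_scheme \<Rightarrow> 'a \<Rightarrow> bool" where
  "has_virtual_character G x \<longleftrightarrow>
     (\<exists>L \<phi> (k::nat). finite_index_subgroup G L \<and> \<phi> \<in> hom (G\<lparr>carrier := L\<rparr>) integer_group \<and>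
        x [^]\<^bsub>G\<^esub> k \<in> L \<and> \<phi> (x [^]\<^bsub>G\<^esub> k) \<noteq> 0)"

text \<open>Shrinking \<open>L\<close> to its normal core \<open>N\<close> may lose
  \<open>c [^] k\<close>, but a further positive power returns to \<open>N\<close>, and
  \<open>\<phi>\<close> stays nonzero there because the integers are torsion-free. The extension to
  a subgroup containing \<open>c\<close> then applies.\<close>

lemma (in group) virtual_retract_of_virtual_character:
  assumes c: "c \<in> carrier G" and "has_virtual_character G c"
  shows "virtual_retract G (range (\<lambda>n::int. c [^] n))"
proof -
  obtain L \<phi> and k :: nat where L: "finite_index_subgroup G L"
    and \<phi>: "\<phi> \<in> hom (G\<lparr>carrier := L\<rparr>) integer_group" and ck: "c [^] k \<in> L" "\<phi> (c [^] k) \<noteq> 0"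
    using assms unfolding has_virtual_character_def by blast
  obtain N where N: "finite_index_subgroup G N" "N \<lhd> G" "N \<subseteq> L"
    using finite_index_normal_core[OF L] .
  have \<phi>N: "\<phi> \<in> hom (G\<lparr>carrier := N\<rparr>) integer_group"
    using \<phi> N(3) by (auto simp: hom_def)
  interpret N: normal N G by (rule N)
  obtain r where r: "r > 0" "(c [^] k) [^] (r::nat) \<in> N"
    using finite_index_pow[OF N(1), of "c [^] k"] c by auto
  interpret L: subgroup L G using L by (simp add: finite_index_subgroup_def)
  have "\<phi> ((c [^] k) [^] r) = int r * \<phi> (c [^] k)"
    using hom_nat_pow[OF \<phi>, of "c [^] k" r] ck(1) L.subgroup_is_group[OF is_group]
    by (simp add: nat_pow_consistent[symmetric])
  then have "\<phi> (c [^] (k * r)) \<noteq> 0" "c [^] (k * r) \<in> N"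
    using r ck c by (simp_all add: nat_pow_pow)
  then obtain M \<Psi> where "finite_index_subgroup G M" "c \<in> M"
    "\<Psi> \<in> hom (G\<lparr>carrier := M\<rparr>) integer_group" "\<Psi> c \<noteq> 0"
    using hom_integer_group_extend[OF N(1,2) \<phi>N c] by metis
  then show ?thesis using virtual_retract_range_int_pow by blast
qed

text \<open>Finitely many finite index subgroups exclude all nontrivial elements of
  \<open>C\<close>, and a normal core \<open>N\<close> of their intersection meets \<open>C\<close>
  trivially. The product of \<open>N\<close> and \<open>C\<close> is then semidirect, and its
  projection to \<open>C\<close> is the retraction.\<close>

lemma (in group) virtual_retract_finite_subgroup:
  assumes C: "subgroup C G" "finite C" and rf: "residually_finite G"
  shows "virtual_retract G C"
proof -
  interpret C: subgroup C G by (rule C)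
  obtain L where L: "\<And>x. x \<in> C - {\<one>} \<Longrightarrow> finite_index_subgroup G (L x) \<and> x \<notin> L x"
    using rf C.subset unfolding residually_finite_def by (metis DiffE insertI1 subsetD)
  have "finite_index_subgroup G (carrier G \<inter> (\<Inter>x\<in>C - {\<one>}. L x))"
    using C(2) L by (intro finite_index_subgroup_INT) auto
  then obtain N where N: "finite_index_subgroup G N" "N \<lhd> G"
      "N \<subseteq> carrier G \<inter> (\<Inter>x\<in>C - {\<one>}. L x)"
    using finite_index_normal_core by blast
  interpret N: normal N G by (rule N)
  have inter: "x = \<one>" if "x \<in> N" "x \<in> C" for x
    using that N(3) L[of x] by blast
  \<comment> \<open>This picks the \<open>C\<close>-component of \<open>x\<close>, which is unique
    because \<open>N\<close> and \<open>C\<close> meet trivially.\<close>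
  define \<rho> where "\<rho> x = (SOME y. y \<in> C \<and> x \<otimes> inv y \<in> N)" for x
  have \<rho>: "\<rho> (n \<otimes> y) = y" if "n \<in> N" "y \<in> C" for n y
    unfolding \<rho>_def
  proof (rule some_equality)
    show "y \<in> C \<and> n \<otimes> y \<otimes> inv y \<in> N" using that by (simp add: m_assoc)
    fix z assume z: "z \<in> C \<and> n \<otimes> y \<otimes> inv z \<in> N"
    then have "inv n \<otimes> (n \<otimes> y \<otimes> inv z) \<in> N" using that by blast
    then have "y \<otimes> inv z \<in> N" using that z by (simp add: m_assoc)
    then have "y \<otimes> inv z = \<one>" using inter that z by blast
    then show "z = y" using that z by (metis C.mem_carrier inv_solve_right l_one one_closed)
  qed
  have mult_eq: "(n \<otimes> y) \<otimes> (n' \<otimes> y') = (n \<otimes> (y \<otimes> n' \<otimes> inv y)) \<otimes> (y \<otimes> y')"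
    if "n \<in> N" "n' \<in> N" "y \<in> C" "y' \<in> C" for n n' y y'
    using that by (simp add: m_assoc)
  have set_multI: "n \<otimes> y \<in> N <#> C" if "n \<in> N" "y \<in> C" for n y
    using that by (auto simp: set_mult_def)
  have "subgroup (N <#> C) G"
    using mult_norm_subgroup[OF N(2) C(1)] .
  moreover have "N \<subseteq> N <#> C"
    by (metis N.mem_carrier C.one_closed r_one set_multI subsetI)
  ultimately have "finite_index_subgroup G (N <#> C)"
    using finite_index_subgroup_mono[OF N(1)] by blast
  moreover have "C \<subseteq> N <#> C"
    by (metis C.mem_carrier N.one_closed l_one set_multI subsetI)
  moreover have "\<rho> x \<in> C" if "x \<in> N <#> C" for x
    using that by (auto simp: set_mult_def \<rho>)
  moreover have "\<rho> y = y" if "y \<in> C" for y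
    using \<rho>[of \<one> y] that by simp
  moreover have "\<rho> (x \<otimes> y) = \<rho> x \<otimes> \<rho> y" if "x \<in> N <#> C" "y \<in> N <#> C" for x y
    using that by (auto simp: set_mult_def mult_eq \<rho> N.inv_op_closed2)
  ultimately show ?thesis
    using C(1) by (intro virtual_retractI[where \<rho> = \<rho> and K = "N <#> C"])
qed

text \<open>For the direction from (VRC), take a retraction onto the powers of \<open>x\<close>. If
  \<open>x\<close> has infinite order, its image is a copy of the integers and reading off exponents
  gives a character with value 1 at \<open>x\<close>. If \<open>x\<close> is nontrivial of finite
  order, the kernel has finite index and omits \<open>x\<close>.\<close>

lemma (in group) has_VRC_iff:
  "has_VRC G \<longleftrightarrow> residually_finite G \<and>
     (\<forall>x\<in>carrier G. ord x = 0 \<longrightarrow> has_virtual_character G x)"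
proof safe
  assume rf: "residually_finite G"
    and ch: "\<forall>x\<in>carrier G. ord x = 0 \<longrightarrow> has_virtual_character G x"
  show "has_VRC G"
    unfolding has_VRC_def
  proof safe
    fix C assume C: "subgroup C G" "cyclic_group (G\<lparr>carrier := C\<rparr>)"
    then obtain x where x: "x \<in> C" "C = range (\<lambda>n::int. x [^] n)"
      using cyclic_group_subgroup_iff by blast
    then have xG: "x \<in> carrier G" using C subgroup.mem_carrier by metis
    show "virtual_retract G C"
    proof (cases "ord x = 0")
      case True
      then show ?thesis using virtual_retract_of_virtual_character[OF xG] ch xG x by simp
    next
      case False
      then have "finite C"
        using finite_range_int_pow[OF xG] x by simp
      then show ?thesis using virtual_retract_finite_subgroup C rf by blast
    qed
  qed
next
  assume "has_VRC G"
  then have vr: "virtual_retract G (range (\<lambda>n::int. x [^] n))" if "x \<in> carrier G" for x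
  proof -
    have "x \<in> range (\<lambda>n::int. x [^] n)"
      using int_pow_1[OF that] by (metis rangeI)
    then have "cyclic_group (G\<lparr>carrier := range (\<lambda>n::int. x [^] n)\<rparr>)"
      using cyclic_group_subgroup_iff[OF subgroup_range_int_pow[OF that]] by blast
    then show ?thesis
      using \<open>has_VRC G\<close> subgroup_range_int_pow[OF that] unfolding has_VRC_def by blast
  qed
  have retr: "\<exists>K \<rho>. finite_index_subgroup G K \<and> x \<in> K \<and>
      \<rho> \<in> hom (G\<lparr>carrier := K\<rparr>) (G\<lparr>carrier := range (\<lambda>n::int. x [^] n)\<rparr>) \<and> \<rho> x = x"
    if x: "x \<in> carrier G" for x
  proof -
    let ?C = "range (\<lambda>n::int. x [^] n)"
    have xC: "x \<in> ?C" using int_pow_1[OF x] by (metis rangeI)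
    obtain K where K: "finite_index_subgroup G K" "?C \<subseteq> K" "group_retract (G\<lparr>carrier := K\<rparr>) ?C"
      using vr[OF x] unfolding virtual_retract_def by blast
    have "\<exists>\<rho>\<in>hom (G\<lparr>carrier := K\<rparr>) (G\<lparr>carrier := ?C\<rparr>). \<forall>h\<in>?C. \<rho> h = h"
      using K(3) by (simp add: group_retract_def)
    then show ?thesis using K xC by blast
  qed
  have character: "\<exists>L \<phi>. finite_index_subgroup G L \<and> \<phi> \<in> hom (G\<lparr>carrier := L\<rparr>) integer_group \<and>
      x \<in> L \<and> \<phi> x = 1" if x: "x \<in> carrier G" "ord x = 0" for x
  proof -
    obtain K \<rho> where K: "finite_index_subgroup G K" "x \<in> K"
      and \<rho>: "\<rho> \<in> hom (G\<lparr>carrier := K\<rparr>) (G\<lparr>carrier := range (\<lambda>n::int. x [^] n)\<rparr>)" "\<rho> x = x"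
      using retr[OF x(1)] by blast
    have inj: "x [^] (i::int) = x [^] j \<longleftrightarrow> i = j" for i j
      using x by (auto simp: int_pow_eq)
    \<comment> \<open>The exponent is unique because \<open>x\<close> has infinite order.\<close>
    define \<phi> where "\<phi> y = (THE n::int. x [^] n = \<rho> y)" for y
    have \<phi>: "\<phi> y = n" if "\<rho> y = x [^] n" for y n
      using that by (auto simp: \<phi>_def inj)
    have ex: "\<exists>n::int. \<rho> y = x [^] n" if "y \<in> K" for y
      using \<rho> that by (auto simp: hom_def)
    have "\<phi> (y \<otimes> z) = \<phi> y + \<phi> z" if yz: "y \<in> K" "z \<in> K" for y z
    proof -
      obtain m n :: int where mn: "\<rho> y = x [^] m" "\<rho> z = x [^] n" using ex yz by meson
      have "\<rho> (y \<otimes> z) = x [^] (m + n)"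
        using hom_mult[OF \<rho>(1)] yz mn x by (simp add: int_pow_mult)
      then show ?thesis using \<phi> mn by simp
    qed
    then have "\<phi> \<in> hom (G\<lparr>carrier := K\<rparr>) integer_group"
      by (auto simp: hom_def)
    moreover have "\<phi> x = 1" using \<phi> \<rho>(2) x by simp
    ultimately show ?thesis using K by blast
  qed
  show "has_virtual_character G x" if "x \<in> carrier G" "ord x = 0" for x
    using character[OF that] that unfolding has_virtual_character_def
    by (metis nat_pow_eone zero_neq_one)
  show "residually_finite G"
    unfolding residually_finite_def
  proof safe
    fix x assume x: "x \<in> carrier G" "x \<noteq> \<one>"
    show "\<exists>L. finite_index_subgroup G L \<and> x \<notin> L"
    proof (cases "ord x = 0")
      case True
      then obtain L \<phi> where "finite_index_subgroup G L" "\<phi> \<in> hom (G\<lparr>carrier := L\<rparr>) integer_group"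
        "\<phi> x = 1" using character x by blast
      \<comment> \<open>The elements of even value form the separating subgroup: \<open>x\<close>
        has value 1.\<close>
      then show ?thesis using finite_index_hom_dvd[of L \<phi> 2]
        by (intro exI[of _ "{x \<in> L. 2 dvd \<phi> x}"]) auto
    next
      case False
      let ?C = "range (\<lambda>n::int. x [^] n)"
      have fin: "finite ?C"
        using False by (rule finite_range_int_pow[OF x(1)])
      obtain K \<rho> where K: "finite_index_subgroup G K" "x \<in> K"
        and \<rho>: "\<rho> \<in> hom (G\<lparr>carrier := K\<rparr>) (G\<lparr>carrier := ?C\<rparr>)" "\<rho> x = x"
        using retr[OF x(1)] by blast
      interpret K: group "G\<lparr>carrier := K\<rparr>"
        using K subgroup_imp_group by (simp add: finite_index_subgroup_def)
      interpret C: group "G\<lparr>carrier := ?C\<rparr>"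
        by (rule subgroup_imp_group[OF subgroup_range_int_pow[OF x(1)]])
      interpret \<rho>: group_hom "G\<lparr>carrier := K\<rparr>" "G\<lparr>carrier := ?C\<rparr>" \<rho>
        using \<rho> by unfold_locales
      \<comment> \<open>In a finite group the identity map is a finite invariant for the trivial
        subgroup, whose preimage is the kernel of \<open>\<rho>\<close>.\<close>
      have "finite_index_subgroup (G\<lparr>carrier := ?C\<rparr>) {\<one>}"
        using C.triv_subgroup C.r_inv fin by (intro C.finite_index_subgroupI[where f = id]) simp_all
      then have "finite_index_subgroup (G\<lparr>carrier := K\<rparr>) {y \<in> K. \<rho> y \<in> {\<one>}}"
        using finite_index_subgroup_vimage[OF \<rho>.group_hom_axioms, of "{\<one>}"] by simp
      then have "finite_index_subgroup G {y \<in> K. \<rho> y \<in> {\<one>}}"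
        by (rule finite_index_subgroup_trans[OF K(1)])
      moreover have "x \<notin> {y \<in> K. \<rho> y \<in> {\<one>}}" using \<rho>(2) x(2) by simp
      ultimately show ?thesis by blast
    qed
  qed
qed

section \<open>Passage to overgroups of finite index and to direct products\<close>

lemma has_virtual_character_vimage:
  assumes "group_hom G H h" and x: "x \<in> carrier G" and "has_virtual_character H (h x)"
  shows "has_virtual_character G x"
proof -
  interpret group_hom G H h by fact
  obtain L \<phi> and k :: nat where L: "finite_index_subgroup H L"
    and \<phi>: "\<phi> \<in> hom (H\<lparr>carrier := L\<rparr>) integer_group"
    and k: "h x [^]\<^bsub>H\<^esub> k \<in> L" "\<phi> (h x [^]\<^bsub>H\<^esub> k) \<noteq> 0"
    using assms unfolding has_virtual_character_def by blast
  let ?L = "{y \<in> carrier G. h y \<in> L}"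
  have "finite_index_subgroup G ?L"
    by (rule finite_index_subgroup_vimage[OF group_hom_axioms L])
  moreover have "\<phi> \<circ> h \<in> hom (G\<lparr>carrier := ?L\<rparr>) integer_group"
    using \<phi> by (auto simp: hom_def)
  moreover have "x [^]\<^bsub>G\<^esub> k \<in> ?L" "(\<phi> \<circ> h) (x [^]\<^bsub>G\<^esub> k) \<noteq> 0"
    using k x by (simp_all add: hom_nat_pow)
  ultimately show ?thesis unfolding has_virtual_character_def by blast
qed

text \<open>Elements outside \<open>K\<close> are separated from the identity by \<open>K\<close>
  itself. If \<open>x\<close> has infinite order, so does some power \<open>x [^] m\<close> in
  \<open>K\<close>; a character nonzero at its \<open>k\<close>-th power is nonzero at the power
  \<open>m * k\<close> of \<open>x\<close>, which is why virtual characters are tested on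
  powers.\<close>

lemma (in group) has_VRC_finite_index_subgroup:
  assumes K: "finite_index_subgroup G K" and vrc: "has_VRC (G\<lparr>carrier := K\<rparr>)"
  shows "has_VRC G"
proof -
  interpret K: subgroup K G using K by (simp add: finite_index_subgroup_def)
  interpret KG: group "G\<lparr>carrier := K\<rparr>" by (rule K.subgroup_is_group) (rule is_group)
  have pow: "x [^]\<^bsub>G\<lparr>carrier := K\<rparr>\<^esub> n = x [^] n" for x and n :: nat
    by (simp add: nat_pow_consistent[symmetric])
  have rf: "residually_finite (G\<lparr>carrier := K\<rparr>)"
    and ch: "\<And>x. \<lbrakk>x \<in> K; KG.ord x = 0\<rbrakk> \<Longrightarrow> has_virtual_character (G\<lparr>carrier := K\<rparr>) x"
    using vrc by (auto simp: KG.has_VRC_iff)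
  have "residually_finite G"
    unfolding residually_finite_def
  proof safe
    fix x assume x: "x \<in> carrier G" "x \<noteq> \<one>"
    show "\<exists>L. finite_index_subgroup G L \<and> x \<notin> L"
    proof (cases "x \<in> K")
      case True
      then show ?thesis
        using rf x finite_index_subgroup_trans[OF K] unfolding residually_finite_def by fastforce
    qed (use K in blast)
  qed
  moreover have "has_virtual_character G x" if x: "x \<in> carrier G" "ord x = 0" for x
  proof -
    obtain m :: nat where m: "m > 0" "x [^] m \<in> K"
      using finite_index_pow[OF K x(1)] by blast
    have "(x [^] m) [^] n \<noteq> \<one>" if "n \<noteq> 0" for n :: nat
      using x m that by (simp add: nat_pow_pow ord_eq_0)
    then have "KG.ord (x [^] m) = 0"
      using m by (simp add: KG.ord_eq_0 pow)
    then obtain L \<phi> and k :: nat where "finite_index_subgroup (G\<lparr>carrier := K\<rparr>) L"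
      "\<phi> \<in> hom (G\<lparr>carrier := L\<rparr>) integer_group" "(x [^] m) [^] k \<in> L" "\<phi> ((x [^] m) [^] k) \<noteq> 0"
      using ch[OF m(2)] unfolding has_virtual_character_def by (auto simp: pow)
    then show ?thesis
      using finite_index_subgroup_trans[OF K] x
      unfolding has_virtual_character_def by (metis nat_pow_pow)
  qed
  ultimately show ?thesis by (simp add: has_VRC_iff)
qed

text \<open>A nontrivial element has a nontrivial coordinate, and an element of infinite order has a
  coordinate of infinite order, by finiteness of its support. Both parts of the criterion then pull
  back along the projection to that coordinate.\<close>

lemma has_VRC_sum_group:
  assumes A: "\<And>i. i \<in> I \<Longrightarrow> group (A i)" and vrc: "\<And>i. i \<in> I \<Longrightarrow> has_VRC (A i)"
  shows "has_VRC (sum_group I A)"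
proof -
  let ?S = "sum_group I A"
  interpret S: group ?S using A by (rule sum_group)
  have carrier: "carrier ?S = {x \<in> \<Pi>\<^sub>E i\<in>I. carrier (A i). finite {i \<in> I. x i \<noteq> \<one>\<^bsub>A i\<^esub>}}"
    using A by (rule carrier_sum_group)
  have proj: "group_hom ?S (A i) (\<lambda>x. x i)" if "i \<in> I" for i
    using A[OF that] that S.group_axioms
    by (intro group_hom.intro) (auto simp: group_hom_axioms_def hom_def carrier)
  have rf: "residually_finite (A i)"
    and ch: "\<And>x. \<lbrakk>x \<in> carrier (A i); group.ord (A i) x = 0\<rbrakk> \<Longrightarrow> has_virtual_character (A i) x"
    if "i \<in> I" for i
    using vrc[OF that] by (auto simp: group.has_VRC_iff[OF A[OF that]])
  have "residually_finite ?S"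
    unfolding residually_finite_def
  proof safe
    fix x assume x: "x \<in> carrier ?S" "x \<noteq> \<one>\<^bsub>?S\<^esub>"
    then obtain i where i: "i \<in> I" "x i \<noteq> \<one>\<^bsub>A i\<^esub>"
      by (auto simp: carrier fun_eq_iff PiE_iff extensional_def split: if_splits)
    then obtain L where "finite_index_subgroup (A i) L" "x i \<notin> L"
      using rf x unfolding residually_finite_def carrier by blast
    then show "\<exists>L. finite_index_subgroup ?S L \<and> x \<notin> L"
      using finite_index_subgroup_vimage[OF proj[OF i(1)], of L] by blast
  qed
  moreover have "has_virtual_character ?S x" if x: "x \<in> carrier ?S" "S.ord x = 0" for x
  proof -
    let ?T = "{i \<in> I. x i \<noteq> \<one>\<^bsub>A i\<^esub>}"
    have xi: "x i \<in> carrier (A i)" if "i \<in> I" for i using x that by (auto simp: carrier)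
    have fin: "finite ?T" using x by (auto simp: carrier)
    have "\<exists>i\<in>I. group.ord (A i) (x i) = 0"
    proof (rule ccontr)
      assume "\<not> ?thesis"
      then have nz: "group.ord (A i) (x i) \<noteq> 0" if "i \<in> I" for i using that by metis
      \<comment> \<open>A common multiple of all coordinate orders, since coordinates off the
        support have order 1. It is nonzero because the support is finite and every factor is
        nonzero.\<close>
      define n where "n = (\<Prod>i\<in>?T. group.ord (A i) (x i))"
      have "(x [^]\<^bsub>?S\<^esub> n) i = \<one>\<^bsub>?S\<^esub> i" for i
      proof (cases "i \<in> I")
        case i: True
        interpret Ai: group "A i" using A[OF i] .
        have "Ai.ord (x i) dvd n"
        proof (cases "i \<in> ?T")
          case True
          then show ?thesis unfolding n_def using fin by (intro dvd_prodI)
        qed (use i xi in simp)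
        then have "x i [^]\<^bsub>A i\<^esub> n = \<one>\<^bsub>A i\<^esub>" using Ai.pow_eq_id[OF xi[OF i]] by simp
        then show ?thesis
          using group_hom.hom_nat_pow[OF proj[OF i] x(1), of n] i by simp
      next
        case False
        \<comment> \<open>Outside \<open>I\<close> both functions take the value
          \<open>undefined\<close>, being extensional.\<close>
        have "x [^]\<^bsub>?S\<^esub> n \<in> carrier ?S" using x by simp
        then show ?thesis using False by (auto simp: carrier PiE_iff extensional_def)
      qed
      then have "x [^]\<^bsub>?S\<^esub> n = \<one>\<^bsub>?S\<^esub>" by (rule ext)
      moreover have "n \<noteq> 0" using nz fin by (simp add: n_def)
      ultimately show False using x by (simp add: S.ord_eq_0 del: one_sum_group)
    qed
    then obtain i where i: "i \<in> I" "group.ord (A i) (x i) = 0" by blast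
    then show ?thesis
      using has_virtual_character_vimage[OF proj[OF i(1)] x(1)] ch xi by blast
  qed
  ultimately show ?thesis by (simp add: S.has_VRC_iff)
qed

theorem lemma5p2:
  shows
    "(\<forall>(G :: ('a, 'm) monoid_scheme) K.
        group G \<and> finite_index_subgroup G K \<and> has_VRC (G\<lparr>carrier := K\<rparr>) \<longrightarrow> has_VRC G) \<and>
     (\<forall>(I :: 'i set) (A :: 'i \<Rightarrow> ('b, 'n) monoid_scheme).
        (\<forall>i\<in>I. group (A i) \<and> has_VRC (A i)) \<longrightarrow> has_VRC (sum_group I A))"
proof (intro conjI allI impI)
  fix G :: "('a, 'm) monoid_scheme" and K
  assume "group G \<and> finite_index_subgroup G K \<and> has_VRC (G\<lparr>carrier := K\<rparr>)"
  then show "has_VRC G" by (elim conjE) (rule group.has_VRC_finite_index_subgroup)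
next
  fix I :: "'i set" and A :: "'i \<Rightarrow> ('b, 'n) monoid_scheme"
  assume "\<forall>i\<in>I. group (A i) \<and> has_VRC (A i)"
  then show "has_VRC (sum_group I A)" by (intro has_VRC_sum_group) simp_all
qed

end
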